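(* Let $0<q<1$, let $a$ be a real number, and for $x>0$ let $$h(x)=\log\left[\left(\frac{1-q^x}{1-q}\right)^a\frac{\Gamma_q(x)}{\Gamma_q(x+a)}\right].$$ Then $h'(x)$ is completely monotonic on $(0,\infty)$ for $a\ge 1$.
   Context: For $0<q<1$ the $q$-gamma function is $\Gamma_q(x)=(1-q)^{1-x}\prod_{n=0}^\infty \frac{1-q^{n+1}}{1-q^{n+x}}$. A function $f$ is completely monotonic on an interval $I$ if it has derivatives of all orders on $I$ and $(-1)^n f^{(n)}(x)\ge 0$ for all $x\in I$ and all $n=0,1,2,\dots$. *)

theory Defs
  imports "HOL-Analysis.Analysis"
begin

text \<open>Meant for \<open>0 < q < 1\<close> and real \<open>x\<close> other than \<open>0, -1, -2, \<dots>\<close>, where the product converges and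
  no denominator vanishes.\<close>

definition q_Gamma :: "real \<Rightarrow> real \<Rightarrow> real" where
  "q_Gamma q x =
     (1 - q) powr (1 - x) * (\<Prod>n. (1 - q ^ (n + 1)) / (1 - q powr (real n + x)))"

text \<open>Derivatives are taken within \<open>I\<close>, hence one-sided at endpoints belonging to \<open>I\<close>. This
  determines them uniquely for every interval \<open>I\<close> with more than one point; on an open interval
  they are the ordinary derivatives.\<close>

definition deriv_on :: "real set \<Rightarrow> (real \<Rightarrow> real) \<Rightarrow> real \<Rightarrow> real" where
  "deriv_on I f x = vector_derivative f (at x within I)"

definition completely_monotonic_on :: "real set \<Rightarrow> (real \<Rightarrow> real) \<Rightarrow> bool" where
  "completely_monotonic_on I f \<longleftrightarrow>
     (\<forall>n. (deriv_on I ^^ n) f differentiable_on I) \<and>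
     (\<forall>n. \<forall>x\<in>I. (-1) ^ n * (deriv_on I ^^ n) f x \<ge> 0)"

end

theory Submission
  imports Defs
begin

text \<open>Expanding each logarithm in \<open>ln \<Gamma>\<^sub>q\<close> as a power series and summing the geometric
  series in the product index gives \<open>h x = - (\<Sum>k\<ge>1. c k / k * q\<^bsup>k x\<^esup>)\<close> with
  \<open>c k = a - (1 - q\<^bsup>k a\<^esup>) / (1 - q\<^bsup>k\<^esup>)\<close>, and \<open>c k \<ge> 0\<close> for \<open>a \<ge> 1\<close> by Bernoulli's inequality. Each
  differentiation multiplies the \<open>k\<close>-th term by \<open>k * ln q < 0\<close>, so the signs alternate.\<close>

section \<open>Complete monotonicity from an explicit sequence of derivatives\<close>

lemma has_real_derivative_imp_deriv_on:
  assumes "open I" "x \<in> I" "(f has_real_derivative D) (at x)"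
  shows "deriv_on I f x = D"
proof -
  have "vector_derivative f (at x) = D"
    using assms(3) by (intro vector_derivative_at) (simp only: has_real_derivative_iff_has_vector_derivative)
  then show ?thesis
    unfolding deriv_on_def by (simp only: at_within_open[OF assms(2,1)])
qed

text \<open>On an open set a derivative depends only on nearby values, so agreement with
  \<open>G n\<close> on \<open>I\<close> passes to the next iterate of \<open>deriv_on I\<close>,
  whatever the functions do outside \<open>I\<close>.\<close>

lemma completely_monotonic_onI_derivs:
  fixes f :: "real \<Rightarrow> real" and G :: "nat \<Rightarrow> real \<Rightarrow> real"
  assumes "open I"
    and f: "\<And>x. x \<in> I \<Longrightarrow> f x = G 0 x"
    and G: "\<And>n x. x \<in> I \<Longrightarrow> (G n has_real_derivative G (Suc n) x) (at x)"
    and sign: "\<And>n x. x \<in> I \<Longrightarrow> (-1) ^ n * G n x \<ge> 0"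
  shows "completely_monotonic_on I f"
proof -
  let ?D = "\<lambda>n. (deriv_on I ^^ n) f"
  have step: "(g has_real_derivative G (Suc n) x) (at x)"
    if "\<And>y. y \<in> I \<Longrightarrow> g y = G n y" "x \<in> I" for n g x
    by (rule has_field_derivative_transform_within_open[OF G[OF that(2)] \<open>open I\<close> that(2)])
      (simp add: that(1))
  have eq: "\<forall>x\<in>I. ?D n x = G n x" for n
  proof (induction n)
    case 0
    show ?case using f by simp
  next
    case (Suc n)
    show ?case
    proof
      fix x assume x: "x \<in> I"
      have "(?D n has_real_derivative G (Suc n) x) (at x)"
        using Suc.IH x by (intro step) auto
      then have "deriv_on I (?D n) x = G (Suc n) x"
        by (rule has_real_derivative_imp_deriv_on[OF \<open>open I\<close> x])
      then show "?D (Suc n) x = G (Suc n) x"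
        by (simp only: funpow.simps o_apply)
    qed
  qed
  have diff: "?D n differentiable_on I" for n
  proof (unfold differentiable_on_def, rule ballI, rule differentiable_at_withinI)
    fix x assume x: "x \<in> I"
    have "(?D n has_real_derivative G (Suc n) x) (at x)"
      using eq[of n] x by (intro step) auto
    then show "?D n differentiable at x"
      by (auto simp only: real_differentiable_def)
  qed
  show ?thesis
    unfolding completely_monotonic_on_def using eq sign diff by simp
qed

section \<open>Bernoulli's inequality and power series in \<open>q powr x\<close>\<close>

text \<open>Weighted AM-GM for \<open>t powr a\<close> and 1 with weights \<open>1/a\<close> and
  \<open>1 - 1/a\<close> bounds \<open>t\<close> from above; multiplying by \<open>a\<close> and
  rearranging gives this form of Bernoulli's inequality.\<close>

lemma one_minus_powr_le:
  fixes t a :: real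
  assumes "0 < t" "a \<ge> 1"
  shows "1 - t powr a \<le> a * (1 - t)"
proof -
  have "(t powr a) powr (1/a) * 1 powr (1 - 1/a) \<le> (1/a) * (t powr a) + (1 - 1/a) * 1"
    by (rule Youngs_inequality_0) (use assms in auto)
  then have "t \<le> (1/a) * (t powr a) + (1 - 1/a)"
    using assms by (simp add: powr_powr)
  then have "a * t \<le> a * ((1/a) * (t powr a) + (1 - 1/a))"
    using assms by (intro mult_left_mono) auto
  also have "\<dots> = t powr a + (a - 1)"
    using assms by (simp add: distrib_left right_diff_distrib)
  finally show ?thesis
    by (simp add: algebra_simps)
qed

lemma summable_bounded_powser:
  fixes c :: "nat \<Rightarrow> real"
  assumes "\<And>k. \<bar>c k\<bar> \<le> B" "\<bar>y\<bar> < 1"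
  shows "summable (\<lambda>k. c k * y ^ k)"
proof (rule summable_comparison_test')
  show "summable (\<lambda>k. B * \<bar>y\<bar> ^ k)"
    using assms(2) by (intro summable_mult summable_geometric) auto
  show "norm (c k * y ^ k) \<le> B * \<bar>y\<bar> ^ k" for k
    using assms(1) by (simp add: abs_mult power_abs mult_right_mono)
qed

text \<open>\<open>diffs\<close> shifts the index down by one and the factor \<open>y\<close> shifts
  it back; the term \<open>k = 0\<close> is killed by \<open>real k\<close>.\<close>

lemma sums_mult_index_powser:
  fixes c :: "nat \<Rightarrow> real"
  assumes c: "\<And>y. \<bar>y\<bar> < 1 \<Longrightarrow> summable (\<lambda>k. c k * y ^ k)" and y: "\<bar>y\<bar> < 1"
  shows "(\<lambda>k. (b * real k * c k) * y ^ k) sums (b * y * (\<Sum>k. diffs c k * y ^ k))"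
proof -
  have "summable (\<lambda>k. diffs c k * y ^ k)"
    by (rule termdiff_converges[of y 1]) (use y c in auto)
  then have "(\<lambda>k. (b * y) * (diffs c k * y ^ k)) sums (b * y * (\<Sum>k. diffs c k * y ^ k))"
    by (intro sums_mult summable_sums)
  then have "(\<lambda>k. (b * real (Suc k) * c (Suc k)) * y ^ Suc k) sums
      (b * y * (\<Sum>k. diffs c k * y ^ k))"
    by (simp add: diffs_def mult_ac)
  then show ?thesis
    by (subst (asm) sums_Suc_iff) simp
qed

text \<open>By the chain rule, differentiating in \<open>x\<close> is \<open>ln q\<close> times y
  d/dy at y = \<open>q powr x\<close>. This only rescales the coefficients, so the form of the
  series survives iteration.\<close>

lemma has_real_derivative_powser_powr:
  fixes c :: "nat \<Rightarrow> real"
  assumes q: "0 < q" "q < 1"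
    and c: "\<And>y. \<bar>y\<bar> < 1 \<Longrightarrow> summable (\<lambda>k. c k * y ^ k)"
    and x: "x > 0"
  shows "((\<lambda>x. \<Sum>k. c k * (q powr x) ^ k) has_real_derivative
    (\<Sum>k. (ln q * real k * c k) * (q powr x) ^ k)) (at x)"
proof -
  have y: "\<bar>q powr x\<bar> < 1"
    using q x by (simp add: powr01_less_one)
  have "((\<lambda>y. \<Sum>k. c k * y ^ k) has_real_derivative (\<Sum>k. diffs c k * (q powr x) ^ k))
      (at (q powr x))"
    by (rule termdiffs_strong'[where K = 1]) (use y c in auto)
  moreover have "((\<lambda>x. q powr x) has_real_derivative ln q * q powr x) (at x)"
    using q by (auto intro!: derivative_eq_intros)
  ultimately have "((\<lambda>x. \<Sum>k. c k * (q powr x) ^ k) has_real_derivative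
      (\<Sum>k. diffs c k * (q powr x) ^ k) * (ln q * q powr x)) (at x)"
    by (rule DERIV_chain2)
  then show ?thesis
    using sums_unique[OF sums_mult_index_powser[OF c y, of "ln q"]] by (simp add: mult_ac)
qed

section \<open>The logarithm of the infinite product as a power series\<close>

text \<open>The term \<open>k = 0\<close> vanishes because of \<open>x / 0 = 0\<close>.\<close>

definition q_log_series :: "real \<Rightarrow> real \<Rightarrow> real" where
  "q_log_series q y = (\<Sum>k. 1 / (real k * (1 - q ^ k)) * y ^ k)"

lemma one_minus_power_ge:
  fixes q :: real
  assumes "0 < q" "q < 1" "k > 0"
  shows "1 - q ^ k \<ge> 1 - q"
  using power_decreasing[of 1 k q] assms by simp

lemma q_log_coeff_bound:
  assumes "0 < q" "q < 1"
  shows "\<bar>1 / (real k * (1 - q ^ k))\<bar> \<le> 1 / (1 - q)"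
proof (cases "k = 0")
  case False
  then have "1 * (1 - q) \<le> real k * (1 - q ^ k)"
    using assms one_minus_power_ge[of q k] by (intro mult_mono) auto
  then show ?thesis
    using assms by (simp add: frac_le)
qed (use assms in auto)

lemma q_log_series_sums:
  assumes "0 < q" "q < 1" "\<bar>y\<bar> < 1"
  shows "(\<lambda>k. 1 / (real k * (1 - q ^ k)) * y ^ k) sums q_log_series q y"
  unfolding q_log_series_def
  using summable_bounded_powser[OF q_log_coeff_bound[OF assms(1,2)] assms(3)] by (rule summable_sums)

lemma ln_one_minus_sums:
  fixes y :: real
  assumes "\<bar>y\<bar> < 1"
  shows "(\<lambda>k. - (y ^ k / real k)) sums ln (1 - y)"
  using ln_series'[of "-y"] assms by simp

lemma power_mult_less_one:
  fixes q y :: real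
  assumes "0 < q" "q < 1" "0 < y" "y < 1"
  shows "q ^ n * y < 1"
proof -
  have "q ^ n * y \<le> 1 * y"
    using assms by (intro mult_right_mono power_le_one) auto
  also have "\<dots> < 1"
    using assms by simp
  finally show ?thesis .
qed

text \<open>Together with continuity at \<open>0\<close>, this functional equation telescopes to the sum over the
  product index, so that no interchange of summations is needed.\<close>

lemma q_log_series_diff:
  assumes q: "0 < q" "q < 1" and y: "\<bar>y\<bar> < 1"
  shows "q_log_series q (q * y) - q_log_series q y = ln (1 - y)"
proof -
  have qy: "\<bar>q * y\<bar> < 1"
    using mult_strict_mono[of q 1 "\<bar>y\<bar>" 1] q y by (simp add: abs_mult)
  \<comment> \<open>For \<open>k > 0\<close> the factor \<open>q ^ k - 1\<close> from the difference
    cancels \<open>1 - q ^ k\<close> up to sign, which leaves the series of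
    \<open>ln (1 - y)\<close>.\<close>
  have "1 / (real k * (1 - q ^ k)) * (q * y) ^ k - 1 / (real k * (1 - q ^ k)) * y ^ k
      = - (y ^ k / real k)" for k
  proof (cases "k = 0")
    case False
    then have "1 - q ^ k \<noteq> 0"
      using one_minus_power_ge[of q k] q by simp
    with False show ?thesis
      by (simp add: power_mult_distrib divide_simps) (simp add: algebra_simps)
  qed simp
  then have "(\<lambda>k. - (y ^ k / real k)) sums (q_log_series q (q * y) - q_log_series q y)"
    using sums_diff[OF q_log_series_sums[OF q qy] q_log_series_sums[OF q y]] by simp
  then show ?thesis
    using ln_one_minus_sums[OF y] sums_unique2 by blast
qed

text \<open>Identifies \<open>- q_log_series q y\<close> as the logarithm of the q-Pochhammer symbol
  (y; q)_\<infinity>, out of which the q-gamma function is built.\<close>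

lemma ln_q_product_sums:
  assumes q: "0 < q" "q < 1" and y: "0 < y" "y < 1"
  shows "(\<lambda>n. ln (1 - q ^ n * y)) sums (- q_log_series q y)"
proof -
  have "((\<lambda>y. \<Sum>k. 1 / (real k * (1 - q ^ k)) * y ^ k) has_real_derivative
      (\<Sum>k. diffs (\<lambda>k. 1 / (real k * (1 - q ^ k))) k * 0 ^ k)) (at 0)"
    by (rule termdiffs_strong'[where K = 1])
      (use summable_bounded_powser[OF q_log_coeff_bound[OF q]] in auto)
  then have "isCont (q_log_series q) 0"
    unfolding q_log_series_def using DERIV_isCont by blast
  moreover have "(\<lambda>n. q ^ n * y) \<longlonglongrightarrow> 0"
    using q by (intro tendsto_mult_left_zero LIMSEQ_power_zero) auto
  ultimately have "(\<lambda>n. q_log_series q (q ^ n * y)) \<longlonglongrightarrow> q_log_series q 0"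
    by (rule isCont_tendsto_compose)
  moreover have "q_log_series q 0 = 0"
  proof -
    \<comment> \<open>At \<open>k = 0\<close> the power \<open>0 ^ 0\<close> is 1, but its
      coefficient is \<open>1 / 0 = 0\<close>.\<close>
    have "1 / (real k * (1 - q ^ k)) * 0 ^ k = 0" for k
      by (cases k) auto
    then show ?thesis
      by (simp only: q_log_series_def suminf_zero)
  qed
  ultimately have "(\<lambda>n. q_log_series q (q ^ Suc n * y) - q_log_series q (q ^ n * y)) sums
      (0 - q_log_series q (q ^ 0 * y))"
    by (intro telescope_sums) simp
  moreover have "q_log_series q (q ^ Suc n * y) - q_log_series q (q ^ n * y)
      = ln (1 - q ^ n * y)" for n
  proof -
    have "\<bar>q ^ n * y\<bar> < 1"
      using power_mult_less_one[OF q y, of n] q y by (simp add: abs_mult)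
    from q_log_series_diff[OF q this] show ?thesis
      by (simp add: mult_ac)
  qed
  ultimately show ?thesis by simp
qed

section \<open>Series for the logarithm of the q-gamma ratio\<close>

text \<open>The product is (q; q)_\<infinity> over (y; q)_\<infinity> with y =
  \<open>q powr x\<close>. The exponential form also shows positivity, so that the logarithm of a
  ratio can be split.\<close>

lemma q_Gamma_eq_exp:
  assumes q: "0 < q" "q < 1" and x: "x > 0"
  shows "q_Gamma q x =
    exp ((1 - x) * ln (1 - q) + q_log_series q (q powr x) - q_log_series q q)"
proof -
  have y: "0 < q powr x" "q powr x < 1"
    using q x by (simp_all add: powr01_less_one)
  define s where "s n = ln (1 - q ^ n * q) - ln (1 - q ^ n * q powr x)" for n
  have s: "s sums (q_log_series q (q powr x) - q_log_series q q)"
    unfolding s_def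
    using sums_diff[OF ln_q_product_sums[OF q q] ln_q_product_sums[OF q y]] by simp
  have "(1 - q ^ (n + 1)) / (1 - q powr (real n + x)) = exp (s n)" for n
  proof -
    have "0 < 1 - q ^ n * q" "0 < 1 - q ^ n * q powr x"
      using power_mult_less_one[OF q q, of n] power_mult_less_one[OF q y, of n] by auto
    then show ?thesis
      using q by (simp add: s_def exp_diff powr_add powr_realpow mult.commute)
  qed
  then have "(\<Prod>n. (1 - q ^ (n + 1)) / (1 - q powr (real n + x))) = exp (suminf s)"
    using prodinf_exp[OF sums_summable[OF s]] by simp
  then have "q_Gamma q x = (1 - q) powr (1 - x) * exp (q_log_series q (q powr x) - q_log_series q q)"
    using sums_unique[OF s] by (simp only: q_Gamma_def)
  then show ?thesis
    using q by (simp add: powr_def[of "1 - q"] flip: exp_add)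
qed

text \<open>The constants \<open>q_log_series q q\<close> cancel, and so do all multiples of
  \<open>ln (1 - q)\<close>. The remaining three series merge into one in \<open>q powr x\<close>,
  because the argument \<open>x + a\<close> only contributes a factor \<open>(q ^ k) powr a\<close>
  to the \<open>k\<close>-th term.\<close>

lemma q_Gamma_ratio_series:
  assumes q: "0 < q" "q < 1" and a: "a > 0" and x: "x > 0"
  shows "(\<lambda>k. - ((a - (1 - (q ^ k) powr a) / (1 - q ^ k)) / real k) * (q powr x) ^ k) sums
    ln (((1 - q powr x) / (1 - q)) powr a * (q_Gamma q x / q_Gamma q (x + a)))"
proof -
  define y z where "y = q powr x" and "z = q powr (x + a)"
  have y: "0 < y" "y < 1" and z: "0 < z" "z < 1"
    unfolding y_def z_def using q x a by (simp_all add: powr01_less_one)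
  have "ln (((1 - y) / (1 - q)) powr a * (q_Gamma q x / q_Gamma q (x + a)))
      = a * ln (1 - y) + q_log_series q y - q_log_series q z"
    using q x a y
    by (simp add: q_Gamma_eq_exp ln_mult ln_div y_def z_def algebra_simps)
  moreover have "- ((a - (1 - (q ^ k) powr a) / (1 - q ^ k)) / real k) * y ^ k
      = a * (- (y ^ k / real k)) + 1 / (real k * (1 - q ^ k)) * y ^ k
        - 1 / (real k * (1 - q ^ k)) * z ^ k" for k
  proof (cases "k = 0")
    case False
    then have "1 - q ^ k \<noteq> 0"
      using one_minus_power_ge[of q k] q by simp
    moreover have "z ^ k = y ^ k * (q ^ k) powr a"
      using q by (simp add: y_def z_def powr_power powr_powr powr_add[symmetric]
          powr_realpow[symmetric] algebra_simps)
    ultimately show ?thesis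
      using False by (simp add: divide_simps) (simp add: algebra_simps)
  qed simp
  moreover have "(\<lambda>k. a * (- (y ^ k / real k)) + 1 / (real k * (1 - q ^ k)) * y ^ k
        - 1 / (real k * (1 - q ^ k)) * z ^ k) sums
      (a * ln (1 - y) + q_log_series q y - q_log_series q z)"
    using y z
    by (intro sums_diff sums_add sums_mult ln_one_minus_sums q_log_series_sums[OF q]) auto
  ultimately show ?thesis
    by (simp add: y_def)
qed

section \<open>Signs of the derivatives\<close>

text \<open>The differentiability conjunct ensures that \<open>deriv h\<close> is a genuine
  derivative on the half-line.\<close>

theorem theorem2p6:
  fixes q a :: real and h :: "real \<Rightarrow> real"
  assumes "0 < q" and "q < 1"
    and "\<And>x. x > 0 \<Longrightarrow>
      h x = ln (((1 - q powr x) / (1 - q)) powr a * (q_Gamma q x / q_Gamma q (x + a)))"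
    and "a \<ge> 1"
  shows "h differentiable_on {0<..} \<and> completely_monotonic_on {0<..} (deriv h)"
proof -
  note q = assms(1,2)
  define c where "c k = (a - (1 - (q ^ k) powr a) / (1 - q ^ k)) / real k" for k
  \<comment> \<open>Coefficients of the \<open>n\<close>-th derivative of \<open>h\<close>, the
    factor \<open>ln q * real k\<close> entering once per differentiation.\<close>
  define d where "d n k = (ln q * real k) ^ n * - c k" for n k
  define G where "G n x = (\<Sum>k. d n k * (q powr x) ^ k)" for n x
  \<comment> \<open>The lower bound, Bernoulli at \<open>t = q ^ k\<close>, decides the signs; the
    upper bound serves convergence. Division by zero makes \<open>c 0 = 0\<close>.\<close>
  have c: "0 \<le> c k" "c k \<le> a" for k
  proof -
    have "0 \<le> c k \<and> c k \<le> a"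
    proof (cases "k = 0")
      case False
      then have pos: "1 - q ^ k > 0"
        using one_minus_power_ge[of q k] q by simp
      have "(1 - (q ^ k) powr a) / (1 - q ^ k) \<le> a"
        using one_minus_powr_le[of "q ^ k" a] pos q assms(4) by (simp add: divide_simps)
      moreover have "0 \<le> (1 - (q ^ k) powr a) / (1 - q ^ k)"
        using pos q assms(4) by (intro divide_nonneg_pos) (auto simp: powr_le1)
      moreover have "a \<le> a * real k"
        using False assms(4) by simp
      ultimately have "0 \<le> a - (1 - (q ^ k) powr a) / (1 - q ^ k)"
        "a - (1 - (q ^ k) powr a) / (1 - q ^ k) \<le> a * real k"
        by linarith+
      then show ?thesis
        using False unfolding c_def by (simp add: pos_divide_le_eq)
    qed (use assms(4) in \<open>simp add: c_def\<close>)
    then show "0 \<le> c k" "c k \<le> a" by auto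
  qed
  have d_Suc: "d (Suc n) = (\<lambda>k. ln q * real k * d n k)" for n
    by (simp add: d_def fun_eq_iff)
  \<comment> \<open>Bounded coefficients settle \<open>n = 0\<close>. Later coefficients may grow
    with \<open>k\<close>, so convergence is inherited through termwise differentiation.\<close>
  have summable_d: "summable (\<lambda>k. d n k * y ^ k)" if "\<bar>y\<bar> < 1" for n y
    using that
  proof (induction n arbitrary: y)
    case 0
    show ?case
      using c 0 by (intro summable_bounded_powser[where B = a]) (auto simp: d_def)
  next
    case (Suc n)
    show ?case
      using sums_summable[OF sums_mult_index_powser[OF Suc.IH Suc.prems]] by (simp add: d_Suc)
  qed
  have G: "(G n has_real_derivative G (Suc n) x) (at x)" if "x > 0" for n x
    using has_real_derivative_powser_powr[OF q summable_d that]
    by (simp add: G_def[abs_def] d_Suc)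
  have h: "h x = G 0 x" if "x > 0" for x
    using sums_unique[OF q_Gamma_ratio_series[OF q _ that, of a]] assms(3)[OF that] assms(4)
    by (simp add: G_def d_def c_def)
  have h': "(h has_real_derivative G 1 x) (at x)" if "x > 0" for x
    by (rule has_field_derivative_transform_within_open[of "G 0" _ _ "{0<..}"])
      (use that h G[of x 0] in auto)
  have "h differentiable_on {0<..}"
  proof (unfold differentiable_on_def, rule ballI, rule differentiable_at_withinI)
    fix x :: real assume "x \<in> {0<..}"
    then show "h differentiable at x"
      using h' by (auto simp only: real_differentiable_def greaterThan_iff)
  qed
  moreover have "completely_monotonic_on {0<..} (deriv h)"
  \<comment> \<open>The index is shifted by one because \<open>deriv h\<close> is
    \<open>G 1\<close>.\<close>
  proof (rule completely_monotonic_onI_derivs[where G = "\<lambda>n. G (Suc n)"])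
    fix n and x :: real assume "x \<in> {0<..}"
    then have x: "\<bar>q powr x\<bar> < 1"
      using q by (simp add: powr01_less_one)
    \<comment> \<open>The sign in \<open>- c k\<close> joins the \<open>n\<close> alternating signs,
      so each of the \<open>Suc n\<close> factors becomes \<open>- ln q * real k\<close>, which is
      nonnegative.\<close>
    have "(-1) ^ n * d (Suc n) k = (- ln q * real k) ^ Suc n * c k" for k
      by (simp add: d_def power_mult_distrib power_minus[of "ln q * real k"])
    moreover have "0 \<le> (- ln q * real k) ^ Suc n * c k" for k
      using q c by (intro mult_nonneg_nonneg zero_le_power) (auto simp: mult_nonpos_nonneg)
    ultimately have "0 \<le> ((-1) ^ n * d (Suc n) k) * (q powr x) ^ k" for k
      by (simp only: mult_nonneg_nonneg zero_le_power powr_ge_zero)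
    then have "0 \<le> (\<Sum>k. (-1) ^ n * (d (Suc n) k * (q powr x) ^ k))"
      by (intro suminf_nonneg summable_mult summable_d[OF x]) (simp only: mult.assoc)
    then show "(-1) ^ n * G (Suc n) x \<ge> 0"
      using suminf_mult[OF summable_d[OF x]] by (simp add: G_def)
  qed (use h' G in \<open>auto simp: DERIV_imp_deriv\<close>)
  ultimately show ?thesis ..
qed

end
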